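(* Let $r>0$ and let $f(a,z)=\lambda z+\sum_{k=2}^\infty f_k(a)z^k$ be an essentially quadratic family (i.e. an essentially quadratic perturbation of $f(0,\cdot)$ at $z_0=0$) that is uniformly linearizable for $|a|\le r$. Then the quadratic polynomial $F(z)=\lambda z+z^2$ is linearizable.
   Context: Linearizability: an analytic germ $g(z)=\lambda z+O(z^2)$ at $0$ is linearizable if there are an analytic function $h(z)=z+O(z^2)$ near $0$ and $\varepsilon>0$ such that $g(h(z))=h(\lambda z)$ for $|z|<\varepsilon$. Perturbations: an analytic perturbation of an analytic function $f$ defined near $z_0\in\mathbb{C}$ is an analytic function of two variables $f(a,z)=f(z_0)+f'(z_0)(z-z_0)+\sum_{n=2}^\infty f_n(a)(z-z_0)^n$ defined in a neighborhood of $(0,z_0)$, with $f(0,z)=f(z)$, where the $f_n$ are analytic functions of $a$. It is admissible if each $f_n$ is a polynomial of degree $d_n<n$ (the zero polynomial has degree $-\infty$). It is essentially quadratic if the $f_n$ are polynomials of degree $d_n$ with $d_2=1$ and $d_n<n-1$ for all $n>2$. Uniform linearizability: a family $f(a,z)=\lambda z+\sum_{k\ge2}f_k(a)z^k$ is uniformly linearizable for $|a|\le r$ if there exist $\varepsilon>0$ and a family of conformal (injective analytic) maps $h(a,\cdot)$ with $h(a,z)=z+O(z^2)$ such that $f(a,h(a,z))=h(a,\lambda z)$ (both sides being defined) for all $|a|\le r$ and $|z|<\varepsilon$. *)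

theory Defs
  imports "HOL-Complex_Analysis.Complex_Analysis" "HOL-Library.Landau_Symbols"
begin

text \<open>A germ is represented by a total function of which only the values near 0 matter. As
  \<^term>\<open>eps\<close> may be decreased, the values of \<^term>\<open>h\<close> and \<^term>\<open>g\<close> outside their neighbourhoods of
  analyticity do not affect the notion.\<close>

definition linearizable :: "complex \<Rightarrow> (complex \<Rightarrow> complex) \<Rightarrow> bool" where
  "linearizable lam g \<longleftrightarrow>
     g analytic_on {0} \<and> (\<lambda>z. g z - lam * z) \<in> O[nhds 0](\<lambda>z. z ^ 2) \<and>
     (\<exists>h. h analytic_on {0} \<and> (\<lambda>z. h z - z) \<in> O[nhds 0](\<lambda>z. z ^ 2) \<and>
        (\<exists>eps>0. \<forall>z. norm z < eps \<longrightarrow> g (h z) = h (lam * z)))"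

text \<open>Two-variable analogue of \<^const>\<open>holomorphic_on\<close> for open sets: the derivative exists at
  every point and is complex linear.\<close>

definition analytic2_on :: "(complex \<Rightarrow> complex \<Rightarrow> complex) \<Rightarrow> (complex \<times> complex) set \<Rightarrow> bool" where
  "analytic2_on f U \<longleftrightarrow> open U \<and>
     (\<forall>p\<in>U. \<exists>A B. ((\<lambda>(a, z). f a z) has_derivative (\<lambda>(u, v). A * u + B * v)) (at p))"

text \<open>\<^term>\<open>U\<close> is the domain of the perturbation \<^term>\<open>f\<close> of \<^term>\<open>f0\<close>. The expansion is that of the
  germ of \<^term>\<open>f a\<close> at \<^term>\<open>z0\<close>, for every parameter \<^term>\<open>a\<close> for which this germ is defined; the
  series is not required to converge on all of \<^term>\<open>U\<close>. The values \<^term>\<open>c 0\<close> and \<^term>\<open>c 1\<close> are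
  not used.\<close>

definition analytic_perturbation ::
  "(complex \<Rightarrow> complex) \<Rightarrow> complex \<Rightarrow> (complex \<times> complex) set \<Rightarrow> (complex \<Rightarrow> complex \<Rightarrow> complex) \<Rightarrow>
   (nat \<Rightarrow> complex \<Rightarrow> complex) \<Rightarrow> bool" where
  "analytic_perturbation f0 z0 U f c \<longleftrightarrow>
     f0 analytic_on {z0} \<and>
     (0, z0) \<in> U \<and> analytic2_on f U \<and>
     (\<forall>\<^sub>F z in nhds z0. f 0 z = f0 z) \<and>
     (\<forall>n\<ge>2. c n holomorphic_on {a. (a, z0) \<in> U}) \<and>
     (\<forall>a. (a, z0) \<in> U \<longrightarrow> (\<forall>\<^sub>F z in nhds z0.
        (\<lambda>n. c (n + 2) a * (z - z0) ^ (n + 2)) sums (f a z - f0 z0 - deriv f0 z0 * (z - z0))))"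

text \<open>For \<^term>\<open>n > 2\<close> the convention \<^term>\<open>degree 0 = 0\<close> for the zero polynomial gives the same
  condition as degree minus infinity.\<close>

definition essentially_quadratic_perturbation ::
  "(complex \<Rightarrow> complex) \<Rightarrow> complex \<Rightarrow> (complex \<times> complex) set \<Rightarrow> (complex \<Rightarrow> complex \<Rightarrow> complex) \<Rightarrow> bool"
  where
  "essentially_quadratic_perturbation f0 z0 U f \<longleftrightarrow>
     (\<exists>P :: nat \<Rightarrow> complex poly.
        analytic_perturbation f0 z0 U f (\<lambda>n. poly (P n)) \<and>
        degree (P 2) = 1 \<and> (\<forall>n>2. degree (P n) < n - 1))"

text \<open>\<^term>\<open>D a\<close> is the domain of the conformal map \<^term>\<open>h a\<close>. It may have to be larger than the disc
  of radius \<^term>\<open>eps\<close>, since \<^term>\<open>h a (lam * z)\<close> must be defined also when \<^term>\<open>norm lam > 1\<close>.\<close>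

definition uniformly_linearizable ::
  "complex \<Rightarrow> (complex \<times> complex) set \<Rightarrow> (complex \<Rightarrow> complex \<Rightarrow> complex) \<Rightarrow> real \<Rightarrow> bool" where
  "uniformly_linearizable lam U f r \<longleftrightarrow>
     (\<exists>eps>0. \<exists>D h. \<forall>a. norm a \<le> r \<longrightarrow>
        open (D a) \<and> h a holomorphic_on D a \<and> inj_on (h a) (D a) \<and>
        (\<lambda>z. h a z - z) \<in> O[nhds 0](\<lambda>z. z ^ 2) \<and>
        (\<forall>z. norm z < eps \<longrightarrow>
           z \<in> D a \<and> lam * z \<in> D a \<and> (a, h a z) \<in> U \<and> f a (h a z) = h a (lam * z)))"

end

theory Submission
  imports Defs
begin

text \<open>
  Write \<open>c\<close> for the leading coefficient of the degree-one polynomial \<open>P 2\<close>. For \<open>t \<noteq> 0\<close> the germ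
  \<open>G\<^sub>t(z) = f(a, t z) / t\<close> with \<open>a = 1 / (c t)\<close> is conjugate to \<open>f(a, \<cdot>)\<close>, and its coefficient of
  \<open>z^n\<close> is \<open>t^(n-1) P n (1 / (c t))\<close>. The degree bounds of an essentially quadratic family say
  exactly that these coefficients are polynomials in \<open>t\<close> and that at \<open>t = 0\<close> only
  \<open>G\<^sub>0(z) = \<lambda>z + z\<^sup>2\<close> remains (\<open>rescaled_family\<close>). The quadratic polynomial thus is the limit at
  \<open>a = \<infinity>\<close> of the family, while the hypothesis concerns small \<open>a\<close>, in particular the circle
  \<open>|a| = r\<close>, which is a circle \<open>|t| = R\<close> around \<open>t = 0\<close>. The maximum principle transports
  information about coefficients from this circle to its centre.

  If \<open>\<lambda>^n \<noteq> \<lambda>\<close> for all \<open>n \<ge> 2\<close>, every series with multiplier \<open>\<lambda>\<close> has a unique formal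
  linearization tangent to the identity, whose coefficients are polynomials in those of the series;
  for \<open>G\<^sub>t\<close> they are therefore entire functions of \<open>t\<close> (\<open>holomorphic_lin_coeff\<close>). For \<open>|t| = R\<close> they
  are the coefficients of the rescaled conformal map, which is univalent on a disc whose radius does
  not depend on \<open>t\<close>, so they are at most \<open>M L^n\<close> with uniform \<open>M\<close> and \<open>L\<close>
  (\<open>univalent_coeff_bound\<close>). By the maximum principle the same bound holds at \<open>t = 0\<close>, and the formal
  linearization of the quadratic polynomial converges.

  If \<open>\<lambda>^n = \<lambda>\<close> for some \<open>n \<ge> 2\<close> (\<open>\<lambda>\<close> is zero or a root of unity), the hypothesis is
  contradictory. A linearizable germ with such a multiplier equals its own \<open>n\<close>-th iterate; the
  maximum principle carries this identity from the circle to \<open>t = 0\<close>, where it fails because the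
  iterate has degree \<open>2^n > 2\<close> (\<open>fps_iter_quadratic_neq\<close>).
\<close>

section \<open>Coefficients of univalent functions\<close>

text \<open>If the image contained the disc of radius 2, the inverse map would send that disc into the unit
  disc with derivative 1 at 0, against the Cauchy estimate.\<close>

lemma univalent_omits_value:
  assumes hol: "h holomorphic_on ball 0 1" and inj: "inj_on h (ball 0 1)"
    and h0: "h 0 = 0" and h1: "deriv h 0 = 1"
  obtains w :: complex where "norm w < 2" "w \<notin> h ` ball 0 1"
proof -
  have "\<not> ball 0 2 \<subseteq> h ` ball 0 1"
  proof
    assume sub: "ball 0 2 \<subseteq> h ` ball 0 1"
    obtain g where g: "g holomorphic_on (h ` ball 0 1)"
      "\<And>z. z \<in> ball 0 1 \<Longrightarrow> deriv h z * deriv g (h z) = 1"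
      "\<And>z. z \<in> ball 0 1 \<Longrightarrow> g (h z) = z"
      using holomorphic_has_inverse[OF hol _ inj] by auto
    have "deriv g 0 = 1"
      using g(2)[of 0] h0 h1 by simp
    have holg: "g holomorphic_on ball 0 2"
      using g(1) sub holomorphic_on_subset by blast
    have "norm ((deriv ^^ 1) g 0) \<le> fact 1 * 1 / (3/2) ^ 1"
    proof (rule Cauchy_inequality)
      show "g holomorphic_on ball 0 (3/2)"
        using holg by (rule holomorphic_on_subset) auto
      show "continuous_on (cball 0 (3/2)) g"
        by (rule holomorphic_on_imp_continuous_on, rule holomorphic_on_subset[OF holg]) auto
      fix x :: complex assume "norm (0 - x) = 3/2"
      hence "x \<in> h ` ball 0 1"
        using sub by (auto simp: subset_iff)
      then obtain y where "y \<in> ball 0 1" "x = h y" by blast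
      thus "norm (g x) \<le> 1" using g(3)[of y] by auto
    qed auto
    with \<open>deriv g 0 = 1\<close> show False by simp
  qed
  thus ?thesis using that by (auto simp: subset_iff)
qed

text \<open>An elementary substitute for the Koebe growth theorem, with a worse constant. If \<open>h\<close> omits \<open>w\<close>, then
  \<open>1 - h / w\<close> has a zero-free holomorphic square root. It takes one of the values 1 and -1 at 0,
  and by injectivity of \<open>h\<close> it omits the other one, so that Schottky's theorem bounds it.\<close>

lemma univalent_growth:
  assumes hol: "h holomorphic_on ball 0 1" and inj: "inj_on h (ball 0 1)"
    and h0: "h 0 = 0" and h1: "deriv h 0 = 1" and z: "norm z \<le> 1/4"
  shows "norm (h z) \<le> 2 * (1 + exp (pi * exp (pi * 16)) ^ 2)"
proof -
  obtain w where w: "norm w < 2" "w \<notin> h ` ball 0 1"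
    using univalent_omits_value[OF hol inj h0 h1] .
  have w0: "w \<noteq> 0" using w(2) h0 by force
  have "(\<lambda>z. 1 - h z / w) holomorphic_on ball 0 1"
    using hol w0 by (intro holomorphic_intros) auto
  moreover have "1 - h z / w \<noteq> 0" if "z \<in> ball 0 1" for z
    using w(2) w0 that by (auto simp: field_simps)
  ultimately obtain p0 where p0: "p0 holomorphic_on ball 0 1"
      "\<And>z. z \<in> ball 0 1 \<Longrightarrow> 1 - h z / w = p0 z ^ 2"
    using contractible_imp_holomorphic_sqrt[of "\<lambda>z. 1 - h z / w" "ball 0 1"]
      convex_imp_contractible[OF convex_ball] by metis
  have p00: "p0 0 ^ 2 = 1" using p0(2)[of 0] h0 by simp
  (* Multiplying by - p0 0, a square root of 1, makes p 0 = -1, so that the omitted value is 1.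
     Schottky's theorem wants a closed disc, whence the factor 1/2 in the argument. *)
  define p where "p = (\<lambda>z. - p0 0 * p0 (z / 2))"
  have p_sq: "p u ^ 2 = 1 - h (u / 2) / w" if "u \<in> cball 0 1" for u
    using p0(2)[of "u / 2"] that p00 by (simp add: p_def power_mult_distrib)
  have p_0: "p 0 = -1" using p00 by (simp add: p_def power2_eq_square)
  have "norm (p (2 * z)) \<le> exp (pi * exp (pi * (2 + 2 * 1 + 12 * (1/2) / (1 - 1/2))))"
  proof (rule Schottky[of p 1 "1/2" "2 * z"])
    have "(p0 \<circ> (\<lambda>z. z / 2)) holomorphic_on cball 0 1"
      by (rule holomorphic_on_compose_gen[OF _ p0(1)]) (auto intro!: holomorphic_intros)
    thus "p holomorphic_on cball 0 1"
      unfolding p_def o_def by (intro holomorphic_intros)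
    show "norm (p 0) \<le> 1" using p_0 by simp
    show "\<not> (p u = 0 \<or> p u = 1)" if u: "u \<in> cball 0 1" for u
    proof
      assume *: "p u = 0 \<or> p u = 1"
      have u2: "u / 2 \<in> ball 0 1" using u by simp
      show False
      proof (cases "p u = 0")
        case True
        with p_sq[OF u] have "w = h (u / 2)" using w0 by (simp add: field_simps)
        with w(2) u2 show False by blast
      next
        case False
        with * have "p u = 1" by simp
        with p_sq[OF u] have "h (u / 2) = h 0" using w0 h0 by simp
        from inj_onD[OF inj this u2] have "u / 2 = 0" by simp
        with \<open>p u = 1\<close> p_0 show False by simp
      qed
    qed
    show "norm (2 * z) \<le> 1/2" using z by (simp add: norm_mult)
  qed auto
  hence *: "norm (p (2 * z)) \<le> exp (pi * exp (pi * 16))" by simp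
  have "h z = w * (1 - p (2 * z) ^ 2)"
    using p_sq[of "2 * z"] z w0 by (simp add: norm_mult field_simps)
  hence "norm (h z) = norm w * norm (1 - p (2 * z) ^ 2)" by (simp add: norm_mult)
  also have "\<dots> \<le> 2 * (1 + exp (pi * exp (pi * 16)) ^ 2)"
  proof (rule mult_mono)
    have "norm (1 - p (2 * z) ^ 2) \<le> 1 + norm (p (2 * z)) ^ 2"
      using norm_triangle_ineq4[of 1 "p (2 * z) ^ 2"] by (simp add: norm_power)
    also have "\<dots> \<le> 1 + exp (pi * exp (pi * 16)) ^ 2"
      using power_mono[OF * norm_ge_zero] by simp
    finally show "norm (1 - p (2 * z) ^ 2) \<le> 1 + exp (pi * exp (pi * 16)) ^ 2" .
  qed (use w in auto)
  finally show ?thesis .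
qed

lemma univalent_dilation:
  fixes k :: "complex \<Rightarrow> complex" and e :: real
  assumes k: "k holomorphic_on ball 0 e" "inj_on k (ball 0 e)" "k 0 = 0" "deriv k 0 = 1"
    and e: "e > 0" and s: "s \<noteq> 0"
  defines "h \<equiv> (\<lambda>z. k (s * z) / s)"
  shows "h holomorphic_on ball 0 (e / norm s)" "inj_on h (ball 0 (e / norm s))"
    "h 0 = 0" "deriv h 0 = 1"
proof -
  have sub: "s * z \<in> ball 0 e" if "z \<in> ball 0 (e / norm s)" for z
    using that s by (simp add: norm_mult field_simps)
  have "(k \<circ> (\<lambda>z. s * z)) holomorphic_on ball 0 (e / norm s)"
    by (rule holomorphic_on_compose_gen[OF _ k(1)]) (use sub in \<open>auto intro!: holomorphic_intros\<close>)
  thus "h holomorphic_on ball 0 (e / norm s)"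
    unfolding h_def o_def using s by (intro holomorphic_intros) auto
  show "inj_on h (ball 0 (e / norm s))"
  proof (rule inj_onI)
    fix x y assume xy: "x \<in> ball 0 (e / norm s)" "y \<in> ball 0 (e / norm s)" "h x = h y"
    hence "k (s * x) = k (s * y)" using s by (simp add: h_def)
    from inj_onD[OF k(2) this] sub xy s show "x = y" by simp
  qed
  have "(k has_field_derivative 1) (at 0)"
    using holomorphic_derivI[OF k(1), of 0] e k(4) by simp
  hence "(h has_field_derivative 1) (at 0)"
    unfolding h_def using s
    by (auto intro!: derivative_eq_intros DERIV_chain2[of k 1])
  thus "deriv h 0 = 1" by (rule DERIV_imp_deriv)
  show "h 0 = 0" using k(3) by (simp add: h_def)
qed

text \<open>For the proof it only matters that \<open>M\<close> and \<open>L\<close> depend on the radius alone, not on the map.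
  They come from the growth estimate and the Cauchy inequality on the circle of radius \<open>e / 4\<close>.\<close>

lemma univalent_coeff_bound:
  fixes e :: real
  assumes "e > 0"
  shows "\<exists>M L. L > 0 \<and> (\<forall>k. k holomorphic_on ball 0 e \<and> inj_on k (ball 0 e) \<and> k 0 = 0 \<and> deriv k 0 = 1
           \<longrightarrow> (\<forall>n. norm (fps_nth (fps_expansion k 0) n) \<le> M * L ^ n))"
proof -
  define C where "C = 2 * (1 + exp (pi * exp (pi * 16)) ^ 2)"
  have "norm (fps_nth (fps_expansion k 0) n) \<le> (e * C) * (4 / e) ^ n"
    if k: "k holomorphic_on ball 0 e" "inj_on k (ball 0 e)" "k 0 = 0" "deriv k 0 = 1" for k n
  proof -
    define h where "h = (\<lambda>z. k (of_real e * z) / of_real e)"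
    note h = univalent_dilation[OF k assms, of "of_real e", folded h_def]
    have h': "h holomorphic_on ball 0 1" "inj_on h (ball 0 1)" "h 0 = 0" "deriv h 0 = 1"
      using h assms k(3) by (auto simp: h_def)
    have "norm ((deriv ^^ n) k 0) \<le> fact n * (e * C) / (e / 4) ^ n"
    proof (rule Cauchy_inequality)
      show "k holomorphic_on ball 0 (e/4)"
        using k(1) by (rule holomorphic_on_subset) (use assms in auto)
      show "continuous_on (cball 0 (e/4)) k"
        by (rule holomorphic_on_imp_continuous_on, rule holomorphic_on_subset[OF k(1)])
          (use assms in auto)
      fix x :: complex assume x: "norm (0 - x) = e / 4"
      have "norm (x / of_real e) \<le> 1/4"
        using x assms by (simp add: norm_divide)
      from univalent_growth[OF h' this] have "norm (k x / of_real e) \<le> C"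
        using assms by (simp add: h_def C_def)
      thus "norm (k x) \<le> e * C" using assms by (simp add: norm_divide field_simps)
    qed (use assms in auto)
    thus ?thesis
      by (simp add: fps_expansion_def norm_divide field_simps)
  qed
  thus ?thesis using assms by (intro exI[of _ "e * C"] exI[of _ "4 / e"]) auto
qed

section \<open>Holomorphic families of formal power series\<close>

lemma holomorphic_fps_power_nth:
  assumes "\<And>n. (\<lambda>t. fps_nth (F t) n) holomorphic_on S"
  shows "(\<lambda>t. fps_nth (F t ^ i) n) holomorphic_on S"
proof (induction i arbitrary: n)
  case (Suc i)
  thus ?case unfolding power_Suc fps_mult_nth
    by (intro holomorphic_intros assms)
qed simp

lemma holomorphic_fps_compose_nth:
  assumes "\<And>n. (\<lambda>t. fps_nth (F t) n) holomorphic_on S"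
    and "\<And>n. (\<lambda>t. fps_nth (G t) n) holomorphic_on S"
  shows "(\<lambda>t. fps_nth (fps_compose (F t) (G t)) n) holomorphic_on S"
  unfolding fps_compose_nth
  by (intro holomorphic_intros holomorphic_fps_power_nth assms)

text \<open>The maximum principle in the form in which it moves estimates, and with \<open>B = 0\<close> also identities,
  from the circle to its centre.\<close>

lemma norm_at_0_le_circle:
  fixes g :: "complex \<Rightarrow> complex"
  assumes "g holomorphic_on UNIV" "R > 0" "\<And>t. norm t = R \<Longrightarrow> norm (g t) \<le> B"
  shows "norm (g 0) \<le> B"
  using Cauchy_inequality[of g 0 R B 0] assms
    holomorphic_on_imp_continuous_on[OF holomorphic_on_subset[OF assms(1)]]
    holomorphic_on_subset[OF assms(1)] by auto

section \<open>Formal linearization\<close>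

lemma fps_power_nth_cong:
  assumes "\<And>k. k \<le> n \<Longrightarrow> fps_nth A k = fps_nth B k"
  shows "fps_nth (A ^ i) n = fps_nth (B ^ i) n"
  using assms
proof (induction i arbitrary: n)
  case (Suc i)
  show ?case unfolding power_Suc fps_mult_nth
    by (intro sum.cong arg_cong2[of _ _ _ _ "(*)"] Suc.IH Suc.prems) auto
qed simp

text \<open>Since \<open>A\<close> and \<open>B\<close> have no constant term, a term of order \<open>n\<close> in a product of at least two factors
  cannot contain a coefficient of index \<open>n\<close>. This makes the linearization equation a recursion.\<close>

lemma fps_power_nth_cong_less:
  fixes A B :: "'a::comm_ring_1 fps"
  assumes eq: "\<And>k. k < n \<Longrightarrow> fps_nth A k = fps_nth B k"
    and 0: "fps_nth A 0 = 0" "fps_nth B 0 = 0" and i: "i \<ge> 2"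
  shows "fps_nth (A ^ i) n = fps_nth (B ^ i) n"
proof -
  from i obtain m where m: "i = Suc m" "m > 0" by (cases i) auto
  have "fps_nth A j * fps_nth (A ^ m) (n - j) = fps_nth B j * fps_nth (B ^ m) (n - j)"
    if "j \<le> n" for j
  proof -
    consider "j = 0" | "j = n" | "0 < j" "j < n" using \<open>j \<le> n\<close> by linarith
    thus ?thesis
    proof cases
      case 2
      thus ?thesis using 0 m by (simp add: startsby_zero_power)
    next
      case 3
      thus ?thesis
        by (intro arg_cong2[of _ _ _ _ "(*)"] fps_power_nth_cong eq) auto
    qed (simp add: 0)
  qed
  thus ?thesis unfolding m(1) power_Suc fps_mult_nth by (intro sum.cong) auto
qed

text \<open>Comparing coefficients of order \<open>n\<close>, the summand \<open>i = 1\<close> on the left contributes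
  \<open>\<lambda> K\<^sub>n\<close> and the right-hand side is \<open>\<lambda>^n K\<^sub>n\<close>; the remaining summands involve only earlier
  coefficients of \<open>K\<close>.\<close>

lemma linearizes_iff:
  fixes G K :: "complex fps"
  assumes G: "fps_nth G 0 = 0" "fps_nth G 1 = lam" and K: "fps_nth K 0 = 0" "fps_nth K 1 = 1"
    and nonres: "\<And>n. n \<ge> 2 \<Longrightarrow> lam ^ n \<noteq> lam"
  shows "fps_compose G K = fps_compose K (fps_const lam * fps_X) \<longleftrightarrow>
     (\<forall>n\<ge>2. fps_nth K n = (\<Sum>i=2..n. fps_nth G i * fps_nth (K ^ i) n) / (lam ^ n - lam))"
proof -
  have nth: "fps_nth (fps_compose G K) n =
      lam * fps_nth K n + (\<Sum>i=2..n. fps_nth G i * fps_nth (K ^ i) n)" if "n \<ge> 2" for n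
  proof -
    have "{0..n} = insert 0 (insert 1 {2..n})" using that by auto
    thus ?thesis using G by (simp add: fps_compose_nth)
  qed
  have "fps_nth (fps_compose G K) n = fps_nth (fps_compose K (fps_const lam * fps_X)) n" if "n < 2" for n
    using that G K by (cases n) (auto simp: fps_compose_linear fps_compose_nth)
  hence "fps_compose G K = fps_compose K (fps_const lam * fps_X) \<longleftrightarrow>
    (\<forall>n\<ge>2. fps_nth (fps_compose G K) n = fps_nth (fps_compose K (fps_const lam * fps_X)) n)"
    by (metis fps_ext not_le)
  also have "\<dots> \<longleftrightarrow> (\<forall>n\<ge>2. fps_nth K n = (\<Sum>i=2..n. fps_nth G i * fps_nth (K ^ i) n) / (lam ^ n - lam))"
  proof (intro all_cong1 imp_cong refl)
    fix n :: nat assume n: "2 \<le> n"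
    show "fps_nth (fps_compose G K) n = fps_nth (fps_compose K (fps_const lam * fps_X)) n \<longleftrightarrow>
      fps_nth K n = (\<Sum>i=2..n. fps_nth G i * fps_nth (K ^ i) n) / (lam ^ n - lam)"
      unfolding nth[OF n] fps_compose_linear using nonres[OF n] by (auto simp: field_simps)
  qed
  finally show ?thesis .
qed

text \<open>The recursion of \<open>linearizes_iff\<close>, with \<open>K\<close> truncated below order \<open>n\<close> so that the recursive calls
  visibly terminate. By \<open>fps_power_nth_cong_less\<close> the truncation does not alter the sum.\<close>

function lin_coeff :: "complex \<Rightarrow> complex fps \<Rightarrow> nat \<Rightarrow> complex" where
  "lin_coeff lam G n =
     (if n = 0 then 0 else if n = 1 then 1
      else (\<Sum>i=2..n. fps_nth G i * fps_nth (Abs_fps (\<lambda>k. if k < n then lin_coeff lam G k else 0) ^ i) n)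
           / (lam ^ n - lam))"
  by auto
termination by (relation "Wellfounded.measure (\<lambda>(_, _, n). n)") auto

declare lin_coeff.simps [simp del]

lemma lin_coeff_0 [simp]: "lin_coeff lam G 0 = 0"
  and lin_coeff_1 [simp]: "lin_coeff lam G (Suc 0) = 1"
  by (subst lin_coeff.simps; simp)+

lemma lin_coeff_linearizes:
  assumes G: "fps_nth G 0 = 0" "fps_nth G 1 = lam"
    and nonres: "\<And>n. n \<ge> 2 \<Longrightarrow> lam ^ n \<noteq> lam"
  shows "fps_compose G (Abs_fps (lin_coeff lam G)) =
           fps_compose (Abs_fps (lin_coeff lam G)) (fps_const lam * fps_X)"
proof (subst linearizes_iff[OF G _ _ nonres]; (intro allI impI)?)
  fix n :: nat assume n: "n \<ge> 2"
  have "fps_nth (Abs_fps (\<lambda>k. if k < n then lin_coeff lam G k else 0) ^ i) n =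
        fps_nth (Abs_fps (lin_coeff lam G) ^ i) n" if "i \<ge> 2" for i
    using that n by (intro fps_power_nth_cong_less) auto
  thus "fps_nth (Abs_fps (lin_coeff lam G)) n =
     (\<Sum>i=2..n. fps_nth G i * fps_nth (Abs_fps (lin_coeff lam G) ^ i) n) / (lam ^ n - lam)"
    using n by (simp add: lin_coeff.simps[of lam G n])
qed auto

lemma lin_coeff_unique:
  assumes G: "fps_nth G 0 = 0" "fps_nth G 1 = lam"
    and nonres: "\<And>n. n \<ge> 2 \<Longrightarrow> lam ^ n \<noteq> lam"
    and K: "fps_nth K 0 = 0" "fps_nth K 1 = 1"
    and eq: "fps_compose G K = fps_compose K (fps_const lam * fps_X)"
  shows "fps_nth K n = lin_coeff lam G n"
proof (induction n rule: less_induct)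
  case (less n)
  consider "n = 0" | "n = 1" | "n \<ge> 2" by linarith
  thus ?case
  proof cases
    case 3
    have "fps_nth (Abs_fps (\<lambda>k. if k < n then lin_coeff lam G k else 0) ^ i) n =
          fps_nth (K ^ i) n" if "i \<ge> 2" for i
      using that 3 less K by (intro fps_power_nth_cong_less) auto
    thus ?thesis
      using 3 linearizes_iff[OF G K nonres] eq by (simp add: lin_coeff.simps[of lam G n])
  qed (use K in simp_all)
qed

lemma holomorphic_lin_coeff:
  assumes "\<And>n. (\<lambda>t. fps_nth (G t) n) holomorphic_on S"
    and nonres: "\<And>n. n \<ge> 2 \<Longrightarrow> lam ^ n \<noteq> lam"
  shows "(\<lambda>t. lin_coeff lam (G t) n) holomorphic_on S"
proof (induction n rule: less_induct)
  case (less n)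
  consider "n = 0" | "n = 1" | "n \<ge> 2" by linarith
  thus ?case
  proof cases
    case 3
    have "(\<lambda>t. fps_nth (Abs_fps (\<lambda>k. if k < n then lin_coeff lam (G t) k else 0) ^ i) m)
            holomorphic_on S" for i m
    proof (rule holomorphic_fps_power_nth)
      show "(\<lambda>t. fps_nth (Abs_fps (\<lambda>k. if k < n then lin_coeff lam (G t) k else 0)) j)
              holomorphic_on S" for j
        using less by (cases "j < n") auto
    qed
    hence "(\<lambda>t. (\<Sum>i=2..n. fps_nth (G t) i *
         fps_nth (Abs_fps (\<lambda>k. if k < n then lin_coeff lam (G t) k else 0) ^ i) n) / (lam ^ n - lam))
       holomorphic_on S"
      using nonres[OF 3] by (intro holomorphic_intros assms) auto
    thus ?thesis using 3 by (subst lin_coeff.simps) simp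
  qed simp_all
qed

section \<open>Resonant multipliers\<close>

definition fps_iter :: "complex fps \<Rightarrow> nat \<Rightarrow> complex fps" where
  "fps_iter G n = ((\<lambda>H. fps_compose G H) ^^ n) fps_X"

lemma fps_iter_0 [simp]: "fps_iter G 0 = fps_X"
  and fps_iter_Suc [simp]: "fps_iter G (Suc n) = fps_compose G (fps_iter G n)"
  by (simp_all add: fps_iter_def)

lemma fps_iter_nth_0: "fps_nth G 0 = 0 \<Longrightarrow> fps_nth (fps_iter G n) 0 = 0"
  by (induction n) auto

lemma holomorphic_fps_iter:
  assumes "\<And>n. (\<lambda>t. fps_nth (G t) n) holomorphic_on S"
  shows "(\<lambda>t. fps_nth (fps_iter (G t) m) n) holomorphic_on S"
  by (induction m arbitrary: n) (auto intro!: holomorphic_fps_compose_nth assms)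

lemma fps_iter_conjugate:
  fixes G K :: "complex fps"
  assumes G: "fps_nth G 0 = 0" and K: "fps_nth K 0 = 0"
    and eq: "fps_compose G K = fps_compose K (fps_const lam * fps_X)"
  shows "fps_compose (fps_iter G n) K = fps_compose K (fps_const (lam ^ n) * fps_X)"
proof (induction n)
  case (Suc n)
  have "fps_compose (fps_iter G (Suc n)) K = fps_compose G (fps_compose (fps_iter G n) K)"
    using G K by (simp add: fps_compose_assoc fps_iter_nth_0)
  also have "\<dots> = fps_compose (fps_compose G K) (fps_const (lam ^ n) * fps_X)"
    using K by (simp add: Suc fps_compose_assoc)
  also have "\<dots> = fps_compose K (fps_const (lam ^ Suc n) * fps_X)"
    unfolding eq fps_compose_linear by (simp add: fps_eq_iff power_mult_distrib)
  finally show ?case .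
qed (use K in simp)

text \<open>After conjugation by \<open>K\<close> both sides are multiplication by \<open>\<lambda>^n = \<lambda>\<close>, and \<open>K\<close> can be cancelled
  because its linear coefficient is not zero.\<close>

lemma fps_iter_eq_self_if_resonant:
  fixes G K :: "complex fps"
  assumes G: "fps_nth G 0 = 0" and K: "fps_nth K 0 = 0" "fps_nth K 1 = 1"
    and eq: "fps_compose G K = fps_compose K (fps_const lam * fps_X)"
    and res: "lam ^ n = lam"
  shows "fps_iter G n = G"
proof -
  have "fps_compose (fps_iter G n) K = fps_compose G K"
    using fps_iter_conjugate[OF G K(1) eq, of n] res eq by simp
  thus ?thesis
    using fps_compose_inj_right[of K] K by simp
qed

text \<open>The \<open>n\<close>-th iterate of a quadratic polynomial is a polynomial of degree \<open>2^n\<close>.\<close>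

lemma fps_iter_quadratic_neq:
  assumes n: "n \<ge> 2"
  shows "fps_iter (fps_of_poly [:0, lam, 1:]) n \<noteq> fps_of_poly [:0, lam, 1:]"
proof
  let ?q = "[:0, lam, 1:]"
  assume eq: "fps_iter (fps_of_poly ?q) n = fps_of_poly ?q"
  have "\<exists>p. fps_iter (fps_of_poly ?q) m = fps_of_poly p \<and> coeff p 0 = 0 \<and> degree p = 2 ^ m" for m
  proof (induction m)
    case 0
    show ?case by (rule exI[of _ "[:0, 1:]"]) (simp add: fps_of_poly_fps_X)
  next
    case (Suc m)
    then obtain p where "fps_iter (fps_of_poly ?q) m = fps_of_poly p" "coeff p 0 = 0"
      "degree p = 2 ^ m" by blast
    thus ?case
      by (intro exI[of _ "pcompose ?q p"]) (auto simp: fps_of_poly_pcompose degree_pcompose)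
  qed
  then obtain p where p: "fps_iter (fps_of_poly ?q) n = fps_of_poly p" "degree p = 2 ^ n" by blast
  hence "p = ?q" using eq by (simp add: fps_of_poly_eq_iff)
  hence "(2::nat) ^ n = 2 ^ 1" using p(2) by simp
  hence "n = 1" by (subst (asm) power_inject_exp) auto
  thus False using n by simp
qed

section \<open>Formal and analytic linearization\<close>

lemma has_fps_expansion_bigo:
  assumes F: "f has_fps_expansion F" and "\<And>k. k < n \<Longrightarrow> fps_nth F k = 0"
  shows "f \<in> O[nhds 0](\<lambda>z::complex. z ^ n)"
proof -
  define S where "S = fps_shift n F"
  have FS: "F = S * fps_X ^ n"
    unfolding S_def using assms(2) by (auto simp: fps_eq_iff fps_X_power_mult_right_nth)
  have r: "fps_conv_radius S > 0"
    using F by (simp add: S_def has_fps_expansion_def)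
  have s: "eval_fps S has_fps_expansion S"
    using r by (rule eval_fps_has_fps_expansion)
  have "(\<lambda>z. eval_fps S z * z ^ n) has_fps_expansion F"
    unfolding FS by (intro fps_expansion_intros s)
  hence "\<forall>\<^sub>F z in nhds 0. eval_fps S z * z ^ n = f z"
    using F unfolding has_fps_expansion_def by (auto elim: eventually_elim2)
  moreover have "\<forall>\<^sub>F z in nhds 0. norm (eval_fps S z) < norm (eval_fps S 0) + 1"
  proof -
    have "isCont (eval_fps S) 0" using has_fps_expansion_imp_continuous[OF s, of UNIV] by simp
    hence "((\<lambda>z. norm (eval_fps S z)) \<longlongrightarrow> norm (eval_fps S 0)) (nhds 0)"
      by (intro tendsto_norm) (simp add: continuous_within tendsto_nhds_iff)
    thus ?thesis by (rule order_tendstoD) simp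
  qed
  ultimately have "\<forall>\<^sub>F z in nhds 0. norm (f z) \<le> (norm (eval_fps S 0) + 1) * norm (z ^ n)"
    
  proof eventually_elim
    case (elim z)
    from elim(1) have "norm (f z) = norm (eval_fps S z) * norm (z ^ n)"
      by (simp flip: norm_mult)
    also have "\<dots> \<le> (norm (eval_fps S 0) + 1) * norm (z ^ n)"
      using elim(2) by (intro mult_right_mono) auto
    finally show ?case .
  qed
  thus ?thesis by (rule bigoI)
qed

lemma fps_conv_radius_pos_if_geometric:
  fixes F :: "complex fps"
  assumes "L > 0" "\<And>n. norm (fps_nth F n) \<le> M * L ^ n"
  shows "fps_conv_radius F > 0"
proof -
  have "ereal (norm (complex_of_real (1 / (2 * L)))) \<le> fps_conv_radius F"
    unfolding fps_conv_radius_def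
  proof (rule conv_radius_geI, rule summable_comparison_test)
    show "\<exists>N. \<forall>n\<ge>N. norm (fps_nth F n * complex_of_real (1 / (2 * L)) ^ n) \<le> M * (1/2) ^ n"
    proof (intro exI allI impI)
      fix n
      have "norm (fps_nth F n * complex_of_real (1 / (2 * L)) ^ n)
              = norm (fps_nth F n) * (1 / (2 * L)) ^ n"
        using assms(1) by (simp add: norm_mult norm_power norm_divide power_divide)
      also have "\<dots> \<le> M * L ^ n * (1 / (2 * L)) ^ n"
        using assms by (intro mult_right_mono) auto
      also have "\<dots> = M * (1/2) ^ n"
        using assms(1) by (simp add: power_divide power_mult_distrib)
      finally show "norm (fps_nth F n * complex_of_real (1 / (2 * L)) ^ n) \<le> M * (1/2) ^ n" .
    qed
    show "summable (\<lambda>n. M * (1/2::real) ^ n)" by (intro summable_mult summable_geometric) simp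
  qed
  moreover have "norm (complex_of_real (1 / (2 * L))) > 0" using assms(1) by simp
  ultimately show ?thesis by (metis ereal_less(2) order_less_le_trans)
qed

lemma quadratic_linearizable_if_formal:
  fixes H :: "complex fps"
  assumes H: "fps_nth H 0 = 0" "fps_nth H 1 = 1" and r: "fps_conv_radius H > 0"
    and eq: "fps_compose (fps_of_poly [:0, lam, 1:]) H = fps_compose H (fps_const lam * fps_X)"
  shows "linearizable lam (\<lambda>z. lam * z + z ^ 2)"
  unfolding linearizable_def
proof (intro conjI)
  show "(\<lambda>z. lam * z + z ^ 2) analytic_on {0}"
    by (intro analytic_intros)
  show "(\<lambda>z. lam * z + z ^ 2 - lam * z) \<in> O[nhds 0](\<lambda>z. z ^ 2)" by simp
  let ?h = "eval_fps H"
  have h: "?h has_fps_expansion H" using r by (rule eval_fps_has_fps_expansion)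
  show "\<exists>h. h analytic_on {0} \<and> (\<lambda>z. h z - z) \<in> O[nhds 0](\<lambda>z. z ^ 2) \<and>
        (\<exists>eps>0. \<forall>z. norm z < eps \<longrightarrow> lam * h z + h z ^ 2 = h (lam * z))"
  proof (intro exI[of _ ?h] conjI)
    show "?h analytic_on {0}"
      using has_fps_expansion_imp_holomorphic[OF h] analytic_at by metis
    have "(\<lambda>z. ?h z - z) has_fps_expansion (H - fps_X)"
      by (intro fps_expansion_intros h)
    thus "(\<lambda>z. ?h z - z) \<in> O[nhds 0](\<lambda>z. z ^ 2)"
      by (rule has_fps_expansion_bigo) (use H in \<open>auto simp: less_2_cases_iff\<close>)
    have "(\<lambda>z. lam * ?h z + ?h z ^ 2) has_fps_expansion (fps_const lam * H + H ^ 2)"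
      unfolding power2_eq_square by (intro fps_expansion_intros h)
    moreover have "(?h \<circ> (\<lambda>z. lam * z)) has_fps_expansion fps_compose H (fps_const lam * fps_X)"
      by (intro fps_expansion_intros h) simp
    moreover have "fps_const lam * H + H ^ 2 = fps_compose H (fps_const lam * fps_X)"
      unfolding eq[symmetric] using H
      by (simp add: fps_of_poly_pCons fps_compose_add_distrib fps_compose_mult_distrib
           power2_eq_square algebra_simps)
    ultimately have "\<forall>\<^sub>F z in nhds 0. lam * ?h z + ?h z ^ 2 = ?h (lam * z)"
      unfolding has_fps_expansion_def by (auto elim: eventually_elim2)
    thus "\<exists>eps>0. \<forall>z. norm z < eps \<longrightarrow> lam * ?h z + ?h z ^ 2 = ?h (lam * z)"
      by (auto simp: eventually_nhds_metric)
  qed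
qed

lemma fps_semiconjugacy_of_germs:
  fixes g k :: "complex \<Rightarrow> complex"
  assumes g: "g has_fps_expansion G"
    and k: "k has_fps_expansion K" "fps_nth K 0 = 0"
    and eq: "\<forall>\<^sub>F z in nhds 0. g (k z) = k (lam * z)"
  shows "fps_compose G K = fps_compose K (fps_const lam * fps_X)"
proof -
  have "(g \<circ> k) has_fps_expansion fps_compose G K"
    by (intro fps_expansion_intros g k)
  moreover have "(k \<circ> (\<lambda>z. lam * z)) has_fps_expansion fps_compose K (fps_const lam * fps_X)"
    by (intro fps_expansion_intros k) simp
  hence "(g \<circ> k) has_fps_expansion fps_compose K (fps_const lam * fps_X)"
    unfolding has_fps_expansion_def using eq by (auto elim: eventually_elim2)
  ultimately show ?thesis
    by (intro fps_ext) (metis fps_nth_fps_expansion)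
qed

section \<open>The rescaled family\<close>

lemma tangent_to_identity_bigo:
  assumes h: "h holomorphic_on D" "open D" "0 \<in> D"
    and O: "(\<lambda>z. h z - z) \<in> O[nhds 0](\<lambda>z::complex. z ^ 2)"
  shows "h 0 = 0" "deriv h 0 = 1"
proof -
  obtain c where c: "\<forall>\<^sub>F z in nhds 0. norm (h z - z) \<le> c * norm (z ^ 2)"
    using landau_o.bigE[OF O] by metis
  from eventually_nhds_x_imp_x[OF c] show h0: "h 0 = 0" by simp
  have "((\<lambda>z. (h z - z) / z) \<longlongrightarrow> 0) (at 0)"
  proof (rule Lim_null_comparison)
    show "\<forall>\<^sub>F z in at 0. norm ((h z - z) / z) \<le> c * norm z"
      using c[unfolded eventually_nhds_conv_at] eventually_neq_at_within[of 0 0 UNIV]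
      by (auto elim!: eventually_elim2 simp: norm_divide norm_power norm_mult field_simps power2_eq_square)
    show "((\<lambda>z. c * norm z) \<longlongrightarrow> 0) (at (0::complex))"
      by (auto intro!: tendsto_eq_intros)
  qed
  hence "((\<lambda>z. (h z - z) / z + 1) \<longlongrightarrow> 0 + 1) (at 0)"
    by (intro tendsto_intros)
  hence "((\<lambda>z. (h z - z) / z + 1) \<longlongrightarrow> 1) (at 0)" by simp
  moreover have "\<forall>\<^sub>F z in at 0. (h z - z) / z + 1 = (h z - h 0) / (z - 0)"
    by (auto simp: eventually_at_filter h0 field_simps)
  ultimately have "((\<lambda>z. (h z - h 0) / (z - 0)) \<longlongrightarrow> 1) (at 0)"
    by (rule Lim_transform_eventually)
  hence "(h has_field_derivative 1) (at 0)" by (simp add: has_field_derivative_iff)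
  thus "deriv h 0 = 1" by (rule DERIV_imp_deriv)
qed

text \<open>Each \<open>G t\<close> is defined by its coefficients, which makes sense for every \<open>t\<close>, in particular for
  \<open>t = 0\<close>, where no germ \<open>f(1 / (c t), \<cdot>)\<close> exists. The scaling by \<open>c\<close> makes the quadratic coefficient at
  \<open>t = 0\<close> equal to 1.\<close>

lemma rescaled_family:
  assumes ess: "essentially_quadratic_perturbation (f 0) 0 U f"
    and f00: "f 0 0 = 0" and lam: "deriv (f 0) 0 = lam"
  obtains c :: complex and G :: "complex \<Rightarrow> complex fps" where
    "c \<noteq> 0" "\<And>n. (\<lambda>t. fps_nth (G t) n) holomorphic_on UNIV"
    "G 0 = fps_of_poly [:0, lam, 1:]"
    "\<And>t. fps_nth (G t) 0 = 0" "\<And>t. fps_nth (G t) 1 = lam"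
    "\<And>t. t \<noteq> 0 \<Longrightarrow> (1 / (c * t), 0) \<in> U \<Longrightarrow>
       (\<lambda>z. f (1 / (c * t)) (t * z) / t) has_fps_expansion G t"
proof -
  obtain P :: "nat \<Rightarrow> complex poly" where
    pert: "analytic_perturbation (f 0) 0 U f (\<lambda>n. poly (P n))"
    and P2: "degree (P 2) = 1" and Pn: "\<And>n. n > 2 \<Longrightarrow> degree (P n) < n - 1"
    using ess unfolding essentially_quadratic_perturbation_def by blast
  have deg: "degree (P n) \<le> n - 1" if "n \<ge> 2" for n
    using P2 Pn[of n] that by (cases "n = 2") auto
  define c where "c = coeff (P 2) 1"
  have c: "c \<noteq> 0" using P2 unfolding c_def by (metis degree_0 leading_coeff_0_iff zero_neq_one)
  (* q n is the reversal of P n as a polynomial of formal degree n - 1, scaled by c; its value at 0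
     is the coefficient of P n of order n - 1, which the degree bound kills unless n = 2. *)
  define q where "q = (\<lambda>n t. \<Sum>j\<le>n-1. coeff (P n) j * (1 / c) ^ j * t ^ (n - 1 - j))"
  define G where "G = (\<lambda>t. Abs_fps (\<lambda>n. if n = 0 then 0 else if n = 1 then lam else q n t))"
  have q: "q n t = t ^ (n - 1) * poly (P n) (1 / (c * t))" if "n \<ge> 2" "t \<noteq> 0" for n t
  proof -
    have "poly (P n) (1 / (c * t)) = (\<Sum>j\<le>n-1. coeff (P n) j * (1 / (c * t)) ^ j)"
      unfolding poly_altdef
      by (rule sum.mono_neutral_left) (use deg[OF that(1)] in \<open>auto simp: coeff_eq_0\<close>)
    also have "t ^ (n - 1) * \<dots> = q n t"
      unfolding q_def sum_distrib_left
    proof (rule sum.cong)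
      fix j assume "j \<in> {..n-1}"
      hence "t ^ (n - 1) = t ^ (n - 1 - j) * t ^ j" using that(1)
        by (subst power_add [symmetric]) (auto intro!: arg_cong[of _ _ "\<lambda>m. t ^ m"])
      thus "t ^ (n - 1) * (coeff (P n) j * (1 / (c * t)) ^ j) =
              coeff (P n) j * (1 / c) ^ j * t ^ (n - 1 - j)"
        using that(2) c by (simp add: power_divide power_mult_distrib)
    qed simp
    finally show ?thesis by simp
  qed
  have q0: "q n 0 = (if n = 2 then 1 else 0)" if n: "n \<ge> 2" for n
  proof -
    have "q n 0 = (\<Sum>j\<le>n-1. if j = n - 1 then coeff (P n) (n - 1) * (1 / c) ^ (n - 1) else 0)"
      unfolding q_def by (intro sum.cong) auto
    also have "\<dots> = coeff (P n) (n - 1) * (1 / c) ^ (n - 1)" by simp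
    also have "\<dots> = (if n = 2 then 1 else 0)"
      using c Pn[of n] n by (auto simp: c_def coeff_eq_0)
    finally show ?thesis .
  qed
  show ?thesis
  proof (rule that[of c G])
    show "(\<lambda>t. fps_nth (G t) n) holomorphic_on UNIV" for n
      by (cases "n = 0 \<or> n = 1") (auto simp: G_def q_def intro!: holomorphic_intros)
    show "G 0 = fps_of_poly [:0, lam, 1:]"
    proof (rule fps_ext)
      fix n :: nat
      consider "n = 0" | "n = 1" | "n = 2" | "n > 2" by linarith
      thus "fps_nth (G 0) n = fps_nth (fps_of_poly [:0, lam, 1:]) n"
        by cases (auto simp: G_def q0 coeff_eq_0 numeral_2_eq_2)
    qed
    fix t :: complex
    show "fps_nth (G t) 0 = 0" "fps_nth (G t) 1 = lam" by (simp_all add: G_def)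
    assume t: "t \<noteq> 0" and U: "(1 / (c * t), 0) \<in> U"
    let ?a = "1 / (c * t)"
    have "\<forall>\<^sub>F z in nhds 0. (\<lambda>n. poly (P (n + 2)) ?a * z ^ (n + 2)) sums (f ?a z - lam * z)"
      using pert U f00 lam unfolding analytic_perturbation_def by auto
    moreover have "filterlim (\<lambda>z. t * z) (nhds 0) (nhds 0)"
      by (auto intro!: tendsto_eq_intros filterlim_ident)
    ultimately have "\<forall>\<^sub>F z in nhds 0.
        (\<lambda>n. poly (P (n + 2)) ?a * (t * z) ^ (n + 2)) sums (f ?a (t * z) - lam * (t * z))"
      by (rule eventually_compose_filterlim)
    hence "\<forall>\<^sub>F z in nhds 0. (\<lambda>n. fps_nth (G t) n * z ^ n) sums (f ?a (t * z) / t)"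
    proof eventually_elim
      case (elim z)
      have "poly (P (n + 2)) ?a * (t * z) ^ (n + 2) / t = fps_nth (G t) (n + 2) * z ^ (n + 2)" for n
        using t by (simp add: G_def q power_mult_distrib)
      moreover have "(f ?a (t * z) - lam * (t * z)) / t = f ?a (t * z) / t - lam * z"
        using t by (simp add: diff_divide_distrib)
      ultimately have "(\<lambda>n. fps_nth (G t) (n + 2) * z ^ (n + 2)) sums (f ?a (t * z) / t - lam * z)"
        using sums_divide[OF elim, of t] by (simp only:)
      thus ?case
        by (subst (asm) sums_iff_shift) (simp add: G_def numeral_2_eq_2)
    qed
    thus "(\<lambda>z. f ?a (t * z) / t) has_fps_expansion G t"
      by (rule has_fps_expansionI)
  qed (rule c)
qed

text \<open>The conformal map scales together with the germ. The radius of its disc depends on \<open>t\<close> only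
  through \<open>|t|\<close>, hence is constant on the circle \<open>|t| = R\<close>.\<close>

lemma rescaled_linearization:
  assumes eps: "eps > 0" and t: "t \<noteq> 0"
    and h: "open D" "h holomorphic_on D" "inj_on h D"
      "(\<lambda>z. h z - z) \<in> O[nhds 0](\<lambda>z::complex. z ^ 2)"
    and D: "\<And>z. norm z < eps \<Longrightarrow> z \<in> D \<and> g (h z) = h (lam * z)"
    and G: "(\<lambda>z. g (t * z) / t) has_fps_expansion G"
  obtains k where "k holomorphic_on ball 0 (eps / norm t)" "inj_on k (ball 0 (eps / norm t))"
    "k 0 = 0" "deriv k 0 = 1"
    "fps_compose G (fps_expansion k 0) = fps_compose (fps_expansion k 0) (fps_const lam * fps_X)"
proof -
  define k where "k = (\<lambda>z. h (t * z) / t)"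
  have sub: "ball 0 eps \<subseteq> D" using D by auto
  have "0 \<in> D" using D[of 0] eps by simp
  note h0 = tangent_to_identity_bigo[OF h(2) h(1) this h(4)]
  have hol: "h holomorphic_on ball 0 eps" using h(2) sub by (rule holomorphic_on_subset)
  have inj: "inj_on h (ball 0 eps)" using h(3) sub by (rule inj_on_subset)
  note k = univalent_dilation[OF hol inj h0 eps t, folded k_def]
  have e: "eps / norm t > 0" using eps t by simp
  have K: "k has_fps_expansion fps_expansion k 0"
    by (rule has_fps_expansion_fps_expansion[OF _ _ k(1)]) (use e in auto)
  have "\<forall>\<^sub>F z in nhds 0. z \<in> ball 0 (eps / norm t)"
    using e by (intro eventually_nhds_in_open) auto
  hence "\<forall>\<^sub>F z in nhds 0. g (t * k z) / t = k (lam * z)"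
  proof eventually_elim
    case (elim z)
    hence "norm (t * z) < eps" using t by (simp add: norm_mult field_simps)
    thus ?case using D[of "t * z"] t by (simp add: k_def mult_ac)
  qed
  hence "fps_compose G (fps_expansion k 0) = fps_compose (fps_expansion k 0) (fps_const lam * fps_X)"
    by (intro fps_semiconjugacy_of_germs[OF G K]) (use h0 in \<open>simp_all add: fps_expansion_def k_def\<close>)
  moreover have "k 0 = 0" using h0 by (simp add: k_def)
  ultimately show ?thesis using k by (intro that)
qed

theorem proposition3p5:
  fixes r :: real and lam :: complex
    and U :: "(complex \<times> complex) set" and f :: "complex \<Rightarrow> complex \<Rightarrow> complex"
  assumes "r > 0"
    and "essentially_quadratic_perturbation (f 0) 0 U f"
    and "f 0 0 = 0" and "deriv (f 0) 0 = lam"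
    and "uniformly_linearizable lam U f r"
  shows "linearizable lam (\<lambda>z. lam * z + z ^ 2)"
proof -
  obtain c G where c: "c \<noteq> 0" and G_hol: "\<And>n. (\<lambda>t. fps_nth (G t) n) holomorphic_on UNIV"
    and G_0: "G 0 = fps_of_poly [:0, lam, 1:]"
    and G_nth: "\<And>t. fps_nth (G t) 0 = 0" "\<And>t. fps_nth (G t) 1 = lam"
    and G_exp: "\<And>t. t \<noteq> 0 \<Longrightarrow> (1 / (c * t), 0) \<in> U \<Longrightarrow>
       (\<lambda>z. f (1 / (c * t)) (t * z) / t) has_fps_expansion G t"
    using rescaled_family[OF assms(2-4)] by blast
  obtain eps D h where eps: "eps > 0" and
    unif: "\<And>a. norm a \<le> r \<Longrightarrow>
        open (D a) \<and> h a holomorphic_on D a \<and> inj_on (h a) (D a) \<and>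
        (\<lambda>z. h a z - z) \<in> O[nhds 0](\<lambda>z. z ^ 2) \<and>
        (\<forall>z. norm z < eps \<longrightarrow>
           z \<in> D a \<and> lam * z \<in> D a \<and> (a, h a z) \<in> U \<and> f a (h a z) = h a (lam * z))"
    using assms(5) unfolding uniformly_linearizable_def by blast
  (* The circle |t| = R corresponds to |a| = r under a = 1 / (c t). *)
  define R where "R = 1 / (norm c * r)"
  have R: "R > 0" using c assms(1) by (simp add: R_def)
  define e where "e = eps / R"
  have e: "e > 0" using eps R by (simp add: e_def)
  have lin: "\<exists>k. k holomorphic_on ball 0 e \<and> inj_on k (ball 0 e) \<and> k 0 = 0 \<and> deriv k 0 = 1 \<and>
      fps_compose (G t) (fps_expansion k 0) =
      fps_compose (fps_expansion k 0) (fps_const lam * fps_X)" if t: "norm t = R" for t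
  proof -
    define a where "a = 1 / (c * t)"
    have t0: "t \<noteq> 0" using t R by auto
    have "norm a \<le> r" using t c assms(1) by (simp add: a_def R_def norm_divide norm_mult)
    note u = unif[OF this]
    have "0 \<in> D a" using u eps by simp
    have "h a 0 = 0"
      by (rule tangent_to_identity_bigo(1)) (use u \<open>0 \<in> D a\<close> in auto)
    hence "(a, 0) \<in> U" using u eps by (metis norm_zero)
    hence exp: "(\<lambda>z. f a (t * z) / t) has_fps_expansion G t"
      using G_exp[OF t0] by (simp add: a_def)
    show ?thesis
      by (rule rescaled_linearization[OF eps t0 _ _ _ _ _ exp, of "D a" "h a" lam])
        (use u in \<open>auto simp: e_def t\<close>)
  qed
  show ?thesis
  proof (cases "\<exists>n\<ge>2. lam ^ n = lam")
    case True
    then obtain n where n: "n \<ge> 2" "lam ^ n = lam" by blast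
    have "fps_nth (fps_iter (G 0) n) m - fps_nth (G 0) m = 0" for m
    proof -
      have "norm (fps_nth (fps_iter (G 0) n) m - fps_nth (G 0) m) \<le> 0"
      proof (rule norm_at_0_le_circle[OF _ R])
        show "(\<lambda>t. fps_nth (fps_iter (G t) n) m - fps_nth (G t) m) holomorphic_on UNIV"
          by (intro holomorphic_intros holomorphic_fps_iter G_hol)
        fix t :: complex assume "norm t = R"
        from lin[OF this] obtain k where "k 0 = 0" "deriv k 0 = 1"
          "fps_compose (G t) (fps_expansion k 0) =
           fps_compose (fps_expansion k 0) (fps_const lam * fps_X)" by blast
        hence "fps_iter (G t) n = G t"
          by (intro fps_iter_eq_self_if_resonant[OF G_nth(1) _ _ _ n(2)])
            (auto simp: fps_expansion_def)
        thus "norm (fps_nth (fps_iter (G t) n) m - fps_nth (G t) m) \<le> 0" by simp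
      qed
      thus ?thesis by simp
    qed
    hence "fps_iter (G 0) n = G 0" by (simp add: fps_eq_iff)
    with fps_iter_quadratic_neq[OF n(1), of lam] show ?thesis by (simp add: G_0)
  next
    case False
    hence nonres: "\<And>n. n \<ge> 2 \<Longrightarrow> lam ^ n \<noteq> lam" by blast
    obtain M L where L: "L > 0" and bound: "\<And>k n. k holomorphic_on ball 0 e \<Longrightarrow>
        inj_on k (ball 0 e) \<Longrightarrow> k 0 = 0 \<Longrightarrow> deriv k 0 = 1 \<Longrightarrow>
        norm (fps_nth (fps_expansion k 0) n) \<le> M * L ^ n"
      using univalent_coeff_bound[OF e] by blast
    define H where "H = Abs_fps (lin_coeff lam (G 0))"
    have "norm (fps_nth H n) \<le> M * L ^ n" for n
      unfolding H_def fps_nth_Abs_fps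
    proof (rule norm_at_0_le_circle[OF _ R])
      show "(\<lambda>t. lin_coeff lam (G t) n) holomorphic_on UNIV"
        by (intro holomorphic_lin_coeff G_hol nonres)
      fix t :: complex assume "norm t = R"
      from lin[OF this] obtain k where k: "k holomorphic_on ball 0 e" "inj_on k (ball 0 e)"
        "k 0 = 0" "deriv k 0 = 1"
        "fps_compose (G t) (fps_expansion k 0) =
         fps_compose (fps_expansion k 0) (fps_const lam * fps_X)" by blast
      have "fps_nth (fps_expansion k 0) n = lin_coeff lam (G t) n"
        using k by (intro lin_coeff_unique G_nth nonres) (auto simp: fps_expansion_def)
      thus "norm (lin_coeff lam (G t) n) \<le> M * L ^ n"
        using bound[OF k(1-4), of n] by simp
    qed
    hence "fps_conv_radius H > 0" by (rule fps_conv_radius_pos_if_geometric[OF L])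
    moreover have "fps_compose (G 0) H = fps_compose H (fps_const lam * fps_X)"
      unfolding H_def by (intro lin_coeff_linearizes G_nth nonres)
    ultimately show ?thesis
      by (intro quadratic_linearizable_if_formal[of H]) (simp_all add: H_def G_0)
  qed
qed

end
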